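(* Let $\zeta$ be an aperiodic primitive reduced constant-shape substitution on $\mathbb{Z}^d$ with alphabet $\mathcal{A}$, expansion matrix $L$ and support $F_1$. Then the quotient group $\operatorname{Aut}(X_\zeta,S,\mathbb{Z}^d)/\langle S\rangle$ is finite. Moreover, a bound for $|\operatorname{Aut}(X_\zeta,S,\mathbb{Z}^d)/\langle S\rangle|$ is given by an explicit formula depending only on $d$, $|\mathcal{A}|$, $\|L^{-1}\|$ and $\|F_1\|$.
   Context: Let $d\ge 1$; $\|\cdot\|$ is the Euclidean norm on $\mathbb{R}^d$ and the induced operator norm on matrices; $\|F\|=\max_{n\in F}\|n\|$ for finite $F\subset\mathbb{Z}^d$. For a finite alphabet $\mathcal{A}$, $\mathcal{A}^{\mathbb{Z}^d}$ carries the product topology and the shift action $(S^{n}x)_{k}=x_{n+k}$. A subshift is a closed shift-invariant subset; it is aperiodic if none of its points $x$ has a nonzero period (a $p\in\mathbb{Z}^d\setminus\{0\}$ with $x_{k+p}=x_k$ for all $k$). A pattern is an element of $\mathcal{A}^P$ with $P\subset\mathbb{Z}^d$ finite (identified up to translation of the support); it occurs in $x$ at $n$ if it equals $x|_{n+P}$. $\operatorname{Aut}(X,S,\mathbb{Z}^d)$ is the group of homeomorphisms of $X$ commuting with all $S^n$; $\langle S\rangle=\{S^n:n\in\mathbb{Z}^d\}$. Constant-shape substitution: let $L$ be a $d\times d$ integer matrix with $\|L\|>1$, $\|L^{-1}\|<1$ (expansion matrix), and let $F_1\subset\mathbb{Z}^d$ be a set of representatives of $\mathbb{Z}^d/L(\mathbb{Z}^d)$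 with $0\in F_1$ (support). A constant-shape substitution is a map $\zeta:\mathcal{A}\to\mathcal{A}^{F_1}$. Its iterates $\zeta^n:\mathcal{A}\to\mathcal{A}^{F_n}$ have expansion matrix $L^n$ and support $F_n$, where $F_{n+1}=F_1+L(F_n)$, and $\zeta^{n+1}(a)_{L(g)+f}=\zeta(\zeta^n(a)_g)_f$ for $g\in F_n,f\in F_1$. Standing assumption: $(F_n)_{n>0}$ is a Følner sequence, i.e. $|F_n\,\Delta\,(m+F_n)|/|F_n|\to0$ for every $m\in\mathbb{Z}^d$. $\zeta$ is primitive if for some $n>0$ every letter occurs in $\zeta^n(a)$ for every $a\in\mathcal{A}$. $X_\zeta$ is the subshift of all $x\in\mathcal{A}^{\mathbb{Z}^d}$ such that every pattern occurring in $x$ occurs in some $\zeta^n(a)$, $n>0$, $a\in\mathcal{A}$. $\zeta$ is aperiodic if $X_\zeta$ is. Reduced: for letters $a\ne b$ put $d_n(\zeta^n(a),\zeta^n(b))=|\{f\in F_n:\zeta^n(a)_f\ne\zeta^n(b)_f\}|/|F_n|$; $\zeta$ is reduced if $\inf_{n,\,a\neq b}d_n(\zeta^n(a),\zeta^n(b))>0$. "Bounded by an explicit formula depending only on given quantities" means: there is an explicit function $B$ of these quantities such that the inequality $|\operatorname{Aut}(X_\zeta,S,\mathbb{Z}^d)/\langle S\rangle|\le B(d,|\mathcal{A}|,\|L^{-1}\|,\|F_1\|)$ holds for all such $\zeta$. *)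

theory Defs
  imports
    "HOL-Analysis.Analysis"
    "HOL-Algebra.Bij"
    "HOL-Algebra.Coset"
    "HOL-Library.Extended_Real"
begin

section \<open>The lattice and its norms\<close>

definition real_vec :: "int ^ 'd \<Rightarrow> real ^ 'd" where
  "real_vec k = (\<chi> i. real_of_int (k $ i))"

abbreviation real_mat :: "int ^ 'd ^ 'd \<Rightarrow> real ^ 'd ^ 'd" where
  "real_mat L \<equiv> map_matrix real_of_int L"

definition op_norm :: "real ^ 'd ^ 'd \<Rightarrow> real" where
  "op_norm A = onorm (\<lambda>v. A *v v)"

definition set_norm :: "(int ^ 'd) set \<Rightarrow> real" where
  "set_norm F = Max ((\<lambda>k. norm (real_vec k)) ` F)"


section \<open>Constant-shape substitutions\<close>

definition expansion_matrix :: "int ^ 'd ^ 'd \<Rightarrow> bool" where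
  "expansion_matrix L \<longleftrightarrow> invertible (real_mat L) \<and>
     op_norm (real_mat L) > 1 \<and> op_norm (matrix_inv (real_mat L)) < 1"

definition is_support :: "int ^ 'd ^ 'd \<Rightarrow> (int ^ 'd) set \<Rightarrow> bool" where
  "is_support L F \<longleftrightarrow> finite F \<and> 0 \<in> F \<and> (\<forall>k. \<exists>!f. f \<in> F \<and> (\<exists>g. k = L *v g + f))"

text \<open>The supports start from \<open>{0}\<close> at level \<open>0\<close>, the support of the identity
  substitution, so that level \<open>1\<close> is \<open>F\<close> itself.\<close>

fun iter_support :: "int ^ 'd ^ 'd \<Rightarrow> (int ^ 'd) set \<Rightarrow> nat \<Rightarrow> (int ^ 'd) set" where
  "iter_support L F 0 = {0}"
| "iter_support L F (Suc n) = {f + L *v g | f g. f \<in> F \<and> g \<in> iter_support L F n}"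

definition folner :: "(nat \<Rightarrow> (int ^ 'd) set) \<Rightarrow> bool" where
  "folner Fs \<longleftrightarrow>
     (\<forall>m. (\<lambda>n. real (card (sym_diff (Fs n) ((+) m ` Fs n))) / real (card (Fs n))) \<longlonglongrightarrow> 0)"

text \<open>The unique decomposition \<open>k = L *v g + f\<close> with \<open>f \<in> F\<close>.\<close>

definition digit :: "int ^ 'd ^ 'd \<Rightarrow> (int ^ 'd) set \<Rightarrow> int ^ 'd \<Rightarrow> int ^ 'd" where
  "digit L F k = (THE f. f \<in> F \<and> (\<exists>g. k = L *v g + f))"

definition quotient :: "int ^ 'd ^ 'd \<Rightarrow> (int ^ 'd) set \<Rightarrow> int ^ 'd \<Rightarrow> int ^ 'd" where
  "quotient L F k = (THE g. k = L *v g + digit L F k)"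

text \<open>A substitution \<open>\<A> \<rightarrow> \<A>\<^sup>F\<close> is a function \<open>\<zeta> :: 'a \<Rightarrow> int ^ 'd \<Rightarrow> 'a\<close> whose values
  \<open>\<zeta> a f\<close> are only ever used for \<open>f \<in> F\<close>.  Likewise the pattern \<open>subst_iter L F \<zeta> n a\<close>
  is meaningful only on \<open>iter_support L F n\<close>.\<close>

fun subst_iter ::
  "int ^ 'd ^ 'd \<Rightarrow> (int ^ 'd) set \<Rightarrow> ('a \<Rightarrow> int ^ 'd \<Rightarrow> 'a) \<Rightarrow> nat \<Rightarrow> 'a \<Rightarrow> int ^ 'd \<Rightarrow> 'a" where
  "subst_iter L F \<zeta> 0 a k = a"
| "subst_iter L F \<zeta> (Suc n) a k = \<zeta> (subst_iter L F \<zeta> n a (quotient L F k)) (digit L F k)"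

lemma real_vec_mult: "real_vec (L *v g) = real_mat L *v real_vec g"
  by (simp add: real_vec_def matrix_vector_mult_def vec_eq_iff)

lemma inj_expansion_matrix:
  assumes "expansion_matrix L"
  shows "inj (\<lambda>g. L *v g)"
proof (rule injI)
  fix g h :: "int ^ 'a" assume "L *v g = L *v h"
  then have "real_mat L *v real_vec g = real_mat L *v real_vec h"
    by (simp flip: real_vec_mult)
  moreover have "inj ((*v) (real_mat L))"
    using assms by (auto simp: expansion_matrix_def intro: inj_matrix_vector_mult)
  ultimately have "real_vec g = real_vec h" by (auto dest: injD)
  then show "g = h" by (simp add: real_vec_def vec_eq_iff)
qed

lemma digit_quotient:
  assumes "expansion_matrix L" "is_support L F" "f \<in> F"
  shows "digit L F (L *v g + f) = f" "quotient L F (L *v g + f) = g"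
proof -
  show d: "digit L F (L *v g + f) = f"
    unfolding digit_def using assms(2,3)
    by (intro the1_equality) (auto simp: is_support_def)
  show "quotient L F (L *v g + f) = g"
    unfolding quotient_def d
    by (rule the_equality) (auto dest: injD[OF inj_expansion_matrix[OF assms(1)]])
qed

lemma subst_iter_Suc:
  assumes "expansion_matrix L" "is_support L F" "f \<in> F"
  shows "subst_iter L F \<zeta> (Suc n) a (L *v g + f) = \<zeta> (subst_iter L F \<zeta> n a g) f"
  using digit_quotient[OF assms] by simp

definition primitive_subst ::
  "int ^ 'd ^ 'd \<Rightarrow> (int ^ 'd) set \<Rightarrow> ('a \<Rightarrow> int ^ 'd \<Rightarrow> 'a) \<Rightarrow> bool" where
  "primitive_subst L F \<zeta> \<longleftrightarrow>
     (\<exists>n>0. \<forall>a b. \<exists>f\<in>iter_support L F n. subst_iter L F \<zeta> n a f = b)"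

definition iter_dist ::
  "int ^ 'd ^ 'd \<Rightarrow> (int ^ 'd) set \<Rightarrow> ('a \<Rightarrow> int ^ 'd \<Rightarrow> 'a) \<Rightarrow> nat \<Rightarrow> 'a \<Rightarrow> 'a \<Rightarrow> real" where
  "iter_dist L F \<zeta> n a b =
     real (card {f \<in> iter_support L F n. subst_iter L F \<zeta> n a f \<noteq> subst_iter L F \<zeta> n b f})
       / real (card (iter_support L F n))"

text \<open>The infimum is taken in \<open>ereal\<close>, so that it is \<open>\<infinity>\<close> over the empty family that
  arises from a one-letter alphabet.\<close>

definition reduced_subst ::
  "int ^ 'd ^ 'd \<Rightarrow> (int ^ 'd) set \<Rightarrow> ('a \<Rightarrow> int ^ 'd \<Rightarrow> 'a) \<Rightarrow> bool" where
  "reduced_subst L F \<zeta> \<longleftrightarrow>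
     (INF (n, a, b) \<in> {(n, a, b). 0 < n \<and> a \<noteq> b}. ereal (iter_dist L F \<zeta> n a b)) > 0"


section \<open>Subshifts\<close>

definition shift :: "int ^ 'd \<Rightarrow> (int ^ 'd \<Rightarrow> 'a) \<Rightarrow> int ^ 'd \<Rightarrow> 'a" where
  "shift n x = (\<lambda>k. x (n + k))"

definition full_shift_topology :: "(int ^ 'd \<Rightarrow> 'a) topology" where
  "full_shift_topology = product_topology (\<lambda>_. discrete_topology UNIV) UNIV"

definition aperiodic_subshift :: "(int ^ 'd \<Rightarrow> 'a) set \<Rightarrow> bool" where
  "aperiodic_subshift X \<longleftrightarrow> (\<forall>x\<in>X. \<forall>p. p \<noteq> 0 \<longrightarrow> \<not> (\<forall>k. x (k + p) = x k))"

text \<open>The pattern \<open>w\<close> with support \<open>P\<close> occurs in the configuration or pattern \<open>y\<close> with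
  support \<open>Q\<close>; only the values of \<open>w\<close> on \<open>P\<close> and of \<open>y\<close> on \<open>Q\<close> matter.\<close>

definition occurs_in ::
  "(int ^ 'd) set \<Rightarrow> (int ^ 'd \<Rightarrow> 'a) \<Rightarrow> (int ^ 'd) set \<Rightarrow> (int ^ 'd \<Rightarrow> 'a) \<Rightarrow> bool" where
  "occurs_in P w Q y \<longleftrightarrow> (\<exists>n. \<forall>p\<in>P. n + p \<in> Q \<and> y (n + p) = w p)"

definition subst_shift ::
  "int ^ 'd ^ 'd \<Rightarrow> (int ^ 'd) set \<Rightarrow> ('a \<Rightarrow> int ^ 'd \<Rightarrow> 'a) \<Rightarrow> (int ^ 'd \<Rightarrow> 'a) set" where
  "subst_shift L F \<zeta> = {x. \<forall>P w. finite P \<and> occurs_in P w UNIV x \<longrightarrow>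
     (\<exists>n>0. \<exists>a. occurs_in P w (iter_support L F n) (subst_iter L F \<zeta> n a))}"

lemma shift_in_subst_shift:
  assumes "x \<in> subst_shift L F \<zeta>"
  shows "shift n x \<in> subst_shift L F \<zeta>"
proof -
  have "occurs_in P w UNIV x" if "occurs_in P w UNIV (shift n x)" for P w
    using that unfolding occurs_in_def shift_def by (metis UNIV_I add.assoc)
  with assms show ?thesis by (auto simp: subst_shift_def)
qed


section \<open>The automorphism group\<close>

text \<open>As in \<^const>\<open>BijGroup\<close>, group elements are functions restricted to \<open>X\<close>.\<close>

definition Aut_shift :: "(int ^ 'd \<Rightarrow> 'a) set \<Rightarrow> ((int ^ 'd \<Rightarrow> 'a) \<Rightarrow> int ^ 'd \<Rightarrow> 'a) monoid" where
  "Aut_shift X = BijGroup X \<lparr>carrier :=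
     {\<phi> \<in> Bij X.
        homeomorphic_map (subtopology full_shift_topology X) (subtopology full_shift_topology X) \<phi> \<and>
        (\<forall>n. \<forall>x\<in>X. \<phi> (shift n x) = shift n (\<phi> x))}\<rparr>"

definition shift_group :: "(int ^ 'd \<Rightarrow> 'a) set \<Rightarrow> ((int ^ 'd \<Rightarrow> 'a) \<Rightarrow> int ^ 'd \<Rightarrow> 'a) set" where
  "shift_group X = range (\<lambda>n. restrict (shift n) X)"

lemma topspace_full_shift [simp]:
  "topspace full_shift_topology = UNIV"
  by (simp add: full_shift_topology_def)

lemma shift_0 [simp]: "shift 0 x = x"
  by (simp add: shift_def)

lemma shift_shift: "shift m (shift n x) = shift (m + n) x"
  by (simp add: shift_def add_ac)

lemma continuous_map_shift:
  "continuous_map full_shift_topology full_shift_topology (shift n)"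
  unfolding full_shift_topology_def continuous_map_componentwise_UNIV shift_def
  by (auto intro: continuous_map_product_projection)

lemma subgroup_Aut_shift:
  assumes inv: "\<And>n x. x \<in> X \<Longrightarrow> shift n x \<in> X"
  shows "subgroup (carrier (Aut_shift X)) (BijGroup X)"
proof -
  interpret B: group "BijGroup X" by (rule group_BijGroup)
  let ?T = "subtopology full_shift_topology X"
  show ?thesis
  proof (rule B.subgroupI)
    show "carrier (Aut_shift X) \<subseteq> carrier (BijGroup X)"
      by (auto simp: Aut_shift_def BijGroup_def)
    have "homeomorphic_map ?T ?T (\<lambda>x\<in>X. x)"
      by (rule homeomorphic_map_eq[of _ _ id]) auto
    then show "carrier (Aut_shift X) \<noteq> {}"
      using id_Bij[of X] inv by (auto simp: Aut_shift_def intro!: exI[of _ "\<lambda>x\<in>X. x"])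
  next
    fix f assume f: "f \<in> carrier (Aut_shift X)"
    then have fB: "f \<in> Bij X" and hf: "homeomorphic_map ?T ?T f"
      and cf: "\<And>n x. x \<in> X \<Longrightarrow> f (shift n x) = shift n (f x)"
      by (auto simp: Aut_shift_def)
    have bij: "bij_betw f X X" using fB by (simp add: Bij_def)
    let ?g = "\<lambda>x\<in>X. inv_into X f x"
    have g: "inv\<^bsub>BijGroup X\<^esub> f = ?g"
      by (rule B.inv_equality)
        (use fB in \<open>auto simp: BijGroup_def restrict_inv_into_Bij Bij_compose_restrict_eq\<close>)
    obtain h where h: "homeomorphic_maps ?T ?T f h"
      using hf homeomorphic_map_maps by blast
    have hg: "h x = ?g x" if "x \<in> X" for x
    proof -
      have "f (h x) = x" "h x \<in> X"
        using h that by (auto simp: homeomorphic_maps_def continuous_map_def Pi_iff)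
      then show ?thesis using that bij by (metis bij_betw_inv_into_left restrict_apply')
    qed
    have "homeomorphic_map ?T ?T ?g"
    proof (rule homeomorphic_map_eq)
      show "homeomorphic_map ?T ?T h"
        using homeomorphic_maps_imp_map[OF homeomorphic_maps_sym[THEN iffD1, OF h]] .
    qed (use hg in simp)
    moreover have "?g (shift n x) = shift n (?g x)" if x: "x \<in> X" for n x
    proof -
      have gx: "?g x \<in> X" "f (?g x) = x"
        using bij x by (auto simp: bij_betw_def f_inv_into_f inv_into_into)
      have "f (shift n (?g x)) = shift n x" by (simp only: cf[OF gx(1)] gx(2))
      then show ?thesis
        using bij_betw_inv_into_left[OF bij inv[OF gx(1), of n]] inv[OF x] x by simp
    qed
    ultimately show "inv\<^bsub>BijGroup X\<^esub> f \<in> carrier (Aut_shift X)"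
      unfolding g using restrict_inv_into_Bij[OF fB] by (simp add: Aut_shift_def)
  next
    fix f g assume f: "f \<in> carrier (Aut_shift X)" and g: "g \<in> carrier (Aut_shift X)"
    have B: "f \<in> Bij X" "g \<in> Bij X" using f g by (auto simp: Aut_shift_def)
    have gX: "g x \<in> X" if "x \<in> X" for x using B(2) that Bij_imp_funcset by blast
    have "homeomorphic_map ?T ?T (compose X f g)"
      by (rule homeomorphic_map_eq[OF homeomorphic_map_compose[of ?T ?T g ?T f]])
        (use f g in \<open>auto simp: Aut_shift_def compose_def\<close>)
    moreover have "compose X f g (shift n x) = shift n (compose X f g x)" if "x \<in> X" for n x
      using that f g gX inv by (simp add: Aut_shift_def compose_def)
    ultimately show "f \<otimes>\<^bsub>BijGroup X\<^esub> g \<in> carrier (Aut_shift X)"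
      using B by (simp add: Aut_shift_def BijGroup_def compose_Bij)
  qed
qed

lemma group_Aut_shift:
  assumes inv: "\<And>n x. x \<in> X \<Longrightarrow> shift n x \<in> X"
  shows "group (Aut_shift X)"
  using group.subgroup_imp_group[OF group_BijGroup subgroup_Aut_shift[OF inv]]
  by (simp add: Aut_shift_def)

lemma mult_Aut_shift:
  assumes "f \<in> carrier (Aut_shift X)" "g \<in> carrier (Aut_shift X)"
  shows "f \<otimes>\<^bsub>Aut_shift X\<^esub> g = compose X f g"
  using assms by (simp add: Aut_shift_def BijGroup_def)

lemma shift_in_Aut_shift:
  assumes inv: "\<And>n x. x \<in> X \<Longrightarrow> shift n x \<in> X"
  shows "restrict (shift n) X \<in> carrier (Aut_shift X)"
proof -
  let ?T = "subtopology full_shift_topology X"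
  have c: "continuous_map ?T ?T (shift m)" for m
    using inv by (auto simp: continuous_map_in_subtopology
        intro!: continuous_map_from_subtopology continuous_map_shift)
  have h: "homeomorphic_map ?T ?T (shift n)"
    by (rule homeomorphic_maps_imp_map[of _ _ _ "shift (- n)"])
      (simp add: homeomorphic_maps_def c shift_shift)
  have "homeomorphic_map ?T ?T (restrict (shift n) X)"
    by (rule homeomorphic_map_eq[OF h]) simp
  moreover from this have "bij_betw (restrict (shift n) X) X X"
    using homeomorphic_imp_surjective_map homeomorphic_imp_injective_map
    by (fastforce simp: bij_betw_def)
  ultimately show ?thesis
    using inv by (auto simp: Aut_shift_def Bij_def shift_shift add.commute)
qed

lemma normal_shift_group:
  assumes inv: "\<And>n x. x \<in> X \<Longrightarrow> shift n x \<in> X"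
  shows "shift_group X \<lhd> Aut_shift X"
proof -
  interpret A: group "Aut_shift X" by (rule group_Aut_shift[OF inv])
  note sA = shift_in_Aut_shift[of X, OF inv]
  have comp: "restrict (shift m) X \<otimes>\<^bsub>Aut_shift X\<^esub> restrict (shift n) X = restrict (shift (m + n)) X" for m n
    using inv by (auto simp: mult_Aut_shift sA compose_def shift_shift)
  have one: "\<one>\<^bsub>Aut_shift X\<^esub> = restrict (shift 0) X"
    by (auto simp: Aut_shift_def BijGroup_def)
  have inverse: "inv\<^bsub>Aut_shift X\<^esub> restrict (shift n) X = restrict (shift (- n)) X" for n
    by (rule A.inv_equality) (auto simp: comp one sA)
  have "subgroup (shift_group X) (Aut_shift X)"
    by (rule A.subgroupI) (auto simp: shift_group_def sA inverse comp)
  moreover have "\<phi> \<otimes>\<^bsub>Aut_shift X\<^esub> restrict (shift n) X = restrict (shift n) X \<otimes>\<^bsub>Aut_shift X\<^esub> \<phi>"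
    if "\<phi> \<in> carrier (Aut_shift X)" for \<phi> n
  proof -
    have "\<phi> x \<in> X" if "x \<in> X" for x
      using \<open>\<phi> \<in> _\<close> that Bij_imp_funcset by (fastforce simp: Aut_shift_def)
    then show ?thesis
      using that inv by (auto simp: mult_Aut_shift sA compose_def) (auto simp: Aut_shift_def)
  qed
  ultimately show ?thesis
    by (intro A.normalI) (auto simp: r_coset_def l_coset_def shift_group_def)
qed


section \<open>The explicit bound\<close>

text \<open>Let \<open>l = \<parallel>L\<^sup>-\<^sup>1\<parallel> < 1\<close> and \<open>r = \<parallel>F\<parallel>\<close>.  Points of \<open>L\<^sup>-\<^sup>n F\<^sub>n\<close> have norm at most
  \<open>l * r / (1 - l)\<close>.  If \<open>\<phi>\<close> is an automorphism and \<open>\<phi>'\<close> is defined by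
  \<open>\<zeta>\<^sup>n \<circ> \<phi>' = S\<^sup>j \<circ> \<phi> \<circ> \<zeta>\<^sup>n\<close> with \<open>j \<in> F\<^sub>n\<close>, then for large \<open>n\<close> the letter \<open>(\<phi>' x)\<^sub>0\<close> depends
  only on the coordinates of \<open>x\<close> of norm at most \<open>3 * l * r / (1 - l) + 1\<close>.  The bound below is
  the number of local rules on the cube containing them.\<close>

definition aut_bound :: "nat \<Rightarrow> nat \<Rightarrow> real \<Rightarrow> real \<Rightarrow> nat" where
  "aut_bound d m l r = m ^ (m ^ ((2 * nat \<lceil>3 * l * r / (1 - l)\<rceil> + 3) ^ d))"

end

theory Submission
  imports Defs
begin

text \<open>Fix \<open>x \<in> X\<close> and let \<open>w = \<zeta>\<^sup>n x\<close>.  For an automorphism \<open>\<phi>\<close> the point \<open>\<phi> w\<close> of \<open>X\<close> has the form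
  \<open>S\<^sup>j \<zeta>\<^sup>n y\<close> with \<open>j \<in> F\<^sub>n\<close>.  As \<open>\<zeta>\<^sup>n\<close> is injective on letters, \<open>y\<^sub>g\<close> is determined by the values
  of \<open>x\<close> on \<open>g + W\<close>, where for large \<open>n\<close> the window \<open>W\<close> depends only on \<open>d\<close>, \<open>\<parallel>L\<^sup>-\<^sup>1\<parallel>\<close> and \<open>\<parallel>F\<parallel>\<close>.
  If \<open>\<phi>\<close> and \<open>\<psi>\<close> give the same rule \<open>\<A>\<^sup>W \<rightarrow> \<A>\<close>, then they give the same \<open>y\<close>, so \<open>\<phi> w\<close> is a shift of
  \<open>\<psi> w\<close>, and since the orbit of \<open>w\<close> is dense, \<open>\<phi>\<close> is the composition of \<open>\<psi>\<close> with a shift.  Hence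
  there are at most as many classes of automorphisms as rules.  Recognizability is not
  needed, because \<open>x\<close> and \<open>n\<close> are the same for all automorphisms that are compared.\<close>

section \<open>Lattice vectors and integer cubes\<close>

lemma real_vec_add: "real_vec (k + k') = real_vec k + real_vec k'"
  by (simp add: real_vec_def vec_eq_iff)

lemma real_vec_uminus: "real_vec (- k) = - real_vec k"
  by (simp add: real_vec_def vec_eq_iff)

text \<open>Identifies the cube with a space of functions on the coordinates, so that finiteness and
  size come from \<open>PiE\<close>.\<close>

lemma int_vec_cube_eq_image:
  "{b :: int ^ 'd. \<forall>i. \<bar>b $ i\<bar> \<le> int C} = vec_lambda ` (UNIV \<rightarrow>\<^sub>E {- int C..int C})"
proof (intro equalityI subsetI)
  fix b :: "int ^ 'd" assume "b \<in> {b. \<forall>i. \<bar>b $ i\<bar> \<le> int C}"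
  then have "($) b \<in> UNIV \<rightarrow>\<^sub>E {- int C..int C}" by (auto simp: abs_le_iff minus_le_iff)
  moreover have "b = vec_lambda (($) b)" by simp
  ultimately show "b \<in> vec_lambda ` (UNIV \<rightarrow>\<^sub>E {- int C..int C})" by (simp only: image_eqI)
qed (auto simp: PiE_iff abs_le_iff minus_le_iff)

lemma card_int_vec_cube:
  "finite {b :: int ^ 'd. \<forall>i. \<bar>b $ i\<bar> \<le> int C}"
  "card {b :: int ^ 'd. \<forall>i. \<bar>b $ i\<bar> \<le> int C} = (2 * C + 1) ^ CARD('d)"
proof -
  have "inj_on (vec_lambda :: _ \<Rightarrow> int ^ 'd) S" for S
    by (rule inj_onI) (metis vec_lambda_inverse UNIV_I)
  then show "card {b :: int ^ 'd. \<forall>i. \<bar>b $ i\<bar> \<le> int C} = (2 * C + 1) ^ CARD('d)"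
    unfolding int_vec_cube_eq_image
    by (simp add: card_image card_PiE nat_add_distrib nat_mult_distrib)
qed (auto simp: int_vec_cube_eq_image finite_PiE)


section \<open>Sliding block codes\<close>

text \<open>Cylinders form a base: a basic open box restricts only finitely many coordinates, and in
  a discrete factor it can be shrunk to the singleton \<open>{x i}\<close>.\<close>

lemma openin_full_shift_iff:
  "openin full_shift_topology U \<longleftrightarrow>
     (\<forall>x\<in>U. \<exists>P. finite P \<and> (\<forall>y. (\<forall>p\<in>P. y p = x p) \<longrightarrow> y \<in> U))"
proof
  assume U: "openin full_shift_topology U"
  show "\<forall>x\<in>U. \<exists>P. finite P \<and> (\<forall>y. (\<forall>p\<in>P. y p = x p) \<longrightarrow> y \<in> U)"
  proof
    fix x assume "x \<in> U"
    with U obtain V where V: "finite {i. V i \<noteq> UNIV}" "x \<in> Pi\<^sub>E UNIV V" "Pi\<^sub>E UNIV V \<subseteq> U"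
      unfolding full_shift_topology_def openin_product_topology_alt by fastforce
    have "y \<in> Pi\<^sub>E UNIV V" if "\<forall>p\<in>{i. V i \<noteq> UNIV}. y p = x p" for y
      using V(2) that by (auto simp: PiE_iff) (metis UNIV_I)
    with V show "\<exists>P. finite P \<and> (\<forall>y. (\<forall>p\<in>P. y p = x p) \<longrightarrow> y \<in> U)" by blast
  qed
next
  assume R: "\<forall>x\<in>U. \<exists>P. finite P \<and> (\<forall>y. (\<forall>p\<in>P. y p = x p) \<longrightarrow> y \<in> U)"
  show "openin full_shift_topology U"
    unfolding full_shift_topology_def openin_product_topology_alt
  proof
    fix x assume "x \<in> U"
    with R obtain P where P: "finite P" "\<And>y. (\<forall>p\<in>P. y p = x p) \<Longrightarrow> y \<in> U" by blast
    let ?V = "\<lambda>i. if i \<in> P then {x i} else UNIV"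
    have "Pi\<^sub>E UNIV ?V \<subseteq> U" by (auto simp: PiE_iff intro!: P(2)) (metis singletonD)
    moreover have "finite {i. ?V i \<noteq> UNIV}" by (rule finite_subset[OF _ P(1)]) auto
    moreover have "x \<in> Pi\<^sub>E UNIV ?V" by auto
    ultimately show "\<exists>V. finite {i \<in> UNIV. V i \<noteq> topspace (discrete_topology UNIV)} \<and>
        (\<forall>i\<in>UNIV. openin (discrete_topology UNIV) (V i)) \<and> x \<in> Pi\<^sub>E UNIV V \<and> Pi\<^sub>E UNIV V \<subseteq> U"
      by (intro exI[of _ ?V]) auto
  qed
qed

lemma compact_space_full_shift: "compact_space (full_shift_topology :: (int ^ 'd \<Rightarrow> 'a::finite) topology)"
  by (simp add: full_shift_topology_def compact_space_product_topology)
    (simp add: compact_space_def compactin_discrete_topology)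

text \<open>A forbidden pattern of \<open>x\<close> lies in a finite window, and every configuration
  agreeing with \<open>x\<close> on that window contains it too, so the complement is open.\<close>

lemma closedin_subst_shift: "closedin full_shift_topology (subst_shift L F \<zeta>)"
proof -
  have "openin full_shift_topology (- subst_shift L F \<zeta>)"
    unfolding openin_full_shift_iff
  proof
    fix x assume "x \<in> - subst_shift L F \<zeta>"
    then obtain P w where Pw: "finite P" "occurs_in P w UNIV x"
      "\<not> (\<exists>n>0. \<exists>a. occurs_in P w (iter_support L F n) (subst_iter L F \<zeta> n a))"
      by (auto simp: subst_shift_def)
    from Pw(2) obtain n where n: "\<And>p. p \<in> P \<Longrightarrow> x (n + p) = w p" by (auto simp: occurs_in_def)
    have "y \<in> - subst_shift L F \<zeta>" if "\<forall>p\<in>(+) n ` P. y p = x p" for y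
    proof -
      have "occurs_in P w UNIV y" using that n by (auto simp: occurs_in_def intro!: exI[of _ n])
      with Pw show ?thesis by (auto simp: subst_shift_def)
    qed
    with Pw(1) show "\<exists>P. finite P \<and> (\<forall>y. (\<forall>p\<in>P. y p = x p) \<longrightarrow> y \<in> - subst_shift L F \<zeta>)"
      by (intro exI[of _ "(+) n ` P"]) auto
  qed
  then show ?thesis by (simp add: closedin_def Compl_eq_Diff_UNIV)
qed

text \<open>By continuity each \<open>x\<close> has a finite window \<open>P x\<close> that fixes
  coordinate \<open>k\<close> of the image. The cylinders over these windows cover the compact set
  \<open>X\<close>, and \<open>E\<close> is the union of the windows of a finite subcover.\<close>

lemma curtis_hedlund_lyndon:
  fixes X :: "(int ^ 'd \<Rightarrow> 'a::finite) set"
  assumes X: "closedin full_shift_topology X"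
    and cont: "continuous_map (subtopology full_shift_topology X) full_shift_topology \<phi>"
  obtains E where "finite E"
    "\<And>x y. x \<in> X \<Longrightarrow> y \<in> X \<Longrightarrow> (\<And>e. e \<in> E \<Longrightarrow> x e = y e) \<Longrightarrow> \<phi> x k = \<phi> y k"
proof -
  have "\<exists>P. finite P \<and> (\<forall>y\<in>X. (\<forall>p\<in>P. y p = x p) \<longrightarrow> \<phi> y k = \<phi> x k)" if x: "x \<in> X" for x
  proof -
    have "openin full_shift_topology {y. y k = \<phi> x k}"
      unfolding openin_full_shift_iff by (auto intro!: exI[of _ "{k}"])
    then have "openin (subtopology full_shift_topology X) {y \<in> X. \<phi> y k = \<phi> x k}"
      using openin_continuous_map_preimage[OF cont] by fastforce
    then obtain U where U: "openin full_shift_topology U" "{y \<in> X. \<phi> y k = \<phi> x k} = U \<inter> X"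
      by (auto simp: openin_subtopology)
    with x have "x \<in> U" by blast
    with U(1) obtain P where "finite P" "\<forall>y. (\<forall>p\<in>P. y p = x p) \<longrightarrow> y \<in> U"
      unfolding openin_full_shift_iff by blast
    with U(2) show ?thesis by blast
  qed
  then obtain P where P: "\<And>x. x \<in> X \<Longrightarrow> finite (P x)"
      "\<And>x y. x \<in> X \<Longrightarrow> y \<in> X \<Longrightarrow> (\<forall>p\<in>P x. y p = x p) \<Longrightarrow> \<phi> y k = \<phi> x k"
    by metis
  let ?cyl = "\<lambda>x. {y. \<forall>p\<in>P x. y p = x p}"
  have "compactin full_shift_topology X"
    by (rule closedin_compact_space[OF compact_space_full_shift X])
  moreover have "openin full_shift_topology U" if "U \<in> ?cyl ` X" for U
    unfolding openin_full_shift_iff using P(1) that by fastforce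
  moreover have "X \<subseteq> \<Union>(?cyl ` X)" by auto
  ultimately have "\<exists>\<F>. finite \<F> \<and> \<F> \<subseteq> ?cyl ` X \<and> X \<subseteq> \<Union>\<F>" by (rule compactinD)
  then obtain \<F> where F: "finite \<F>" "\<F> \<subseteq> ?cyl ` X" "X \<subseteq> \<Union>\<F>" by blast
  obtain Y where Y: "finite Y" "Y \<subseteq> X" "\<F> = ?cyl ` Y"
    using finite_subset_image[OF F(1,2)] by blast
  show thesis
  proof
    show "finite (\<Union>(P ` Y))" using Y P(1) by auto
  next
    fix x y assume xy: "x \<in> X" "y \<in> X" "\<And>e. e \<in> \<Union>(P ` Y) \<Longrightarrow> x e = y e"
    \<comment> \<open>\<open>u\<close> is the centre of a cylinder containing \<open>x\<close>;
      since \<open>P u\<close> is part of \<open>E\<close>, it contains \<open>y\<close> as well,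
      and both images agree with that of \<open>u\<close> at \<open>k\<close>.\<close>
    from xy(1) F(3) Y(3) obtain u where u: "u \<in> Y" "\<forall>p\<in>P u. x p = u p" by auto
    with xy(3) have "\<forall>p\<in>P u. y p = u p" by fastforce
    with u Y(2) P(2) xy(1,2) show "\<phi> x k = \<phi> y k" by (metis subsetD)
  qed
qed

text \<open>Commuting with shifts carries the window found at the origin to every position. Two base
  points \<open>k\<close> and \<open>m\<close> are allowed, so that different positions of one point
  can be compared.\<close>

lemma Aut_shift_local_rule:
  fixes X :: "(int ^ 'd \<Rightarrow> 'a::finite) set"
  assumes X: "closedin full_shift_topology X" and inv: "\<And>n x. x \<in> X \<Longrightarrow> shift n x \<in> X"
    and \<phi>: "\<phi> \<in> carrier (Aut_shift X)"
  obtains E where "finite E"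
    "\<And>x y k m. x \<in> X \<Longrightarrow> y \<in> X \<Longrightarrow> (\<And>e. e \<in> E \<Longrightarrow> x (k + e) = y (m + e)) \<Longrightarrow> \<phi> x k = \<phi> y m"
proof -
  let ?T = "subtopology full_shift_topology X"
  from \<phi> have h: "homeomorphic_map ?T ?T \<phi>"
    and c: "\<And>n x. x \<in> X \<Longrightarrow> \<phi> (shift n x) = shift n (\<phi> x)"
    by (auto simp: Aut_shift_def)
  from h have "continuous_map ?T full_shift_topology \<phi>"
    using homeomorphic_imp_continuous_map continuous_map_in_subtopology by blast
  from curtis_hedlund_lyndon[OF X this, of 0] obtain E where E: "finite E"
    "\<And>x y. x \<in> X \<Longrightarrow> y \<in> X \<Longrightarrow> (\<And>e. e \<in> E \<Longrightarrow> x e = y e) \<Longrightarrow> \<phi> x 0 = \<phi> y 0"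
    by metis
  show thesis
  proof
    fix x y k m assume xy: "x \<in> X" "y \<in> X" "\<And>e. e \<in> E \<Longrightarrow> x (k + e) = y (m + e)"
    have "\<phi> (shift k x) 0 = \<phi> (shift m y) 0"
      using xy by (intro E(2) inv) (auto simp: shift_def)
    with xy show "\<phi> x k = \<phi> y m" by (simp add: c) (simp add: shift_def)
  qed fact
qed


section \<open>Substituted configurations\<close>

locale expanding_substitution =
  fixes L :: "int ^ 'd ^ 'd" and F :: "(int ^ 'd) set" and \<zeta> :: "'a::finite \<Rightarrow> int ^ 'd \<Rightarrow> 'a"
  assumes expansion: "expansion_matrix L" and support: "is_support L F"
begin

abbreviation stretch :: "nat \<Rightarrow> int ^ 'd \<Rightarrow> int ^ 'd" where
  "stretch n \<equiv> (*v) L ^^ n"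

text \<open>Index \<open>g\<close> of the translate \<open>stretch n g + F_n\<close> containing the
  given position, where \<open>F_n\<close> is \<open>iter_support L F n\<close>.\<close>

abbreviation block :: "nat \<Rightarrow> int ^ 'd \<Rightarrow> int ^ 'd" where
  "block n \<equiv> quotient L F ^^ n"

text \<open>The configuration \<open>\<zeta>\<^sup>n x\<close>. The recursion follows that of
  \<open>subst_iter\<close>, so iterates on letters are the case of constant configurations.\<close>

primrec subst_conf :: "nat \<Rightarrow> (int ^ 'd \<Rightarrow> 'a) \<Rightarrow> int ^ 'd \<Rightarrow> 'a" where
  "subst_conf 0 x = x"
| "subst_conf (Suc n) x = (\<lambda>k. \<zeta> (subst_conf n x (quotient L F k)) (digit L F k))"

section \<open>Digits, blocks and the tiling by supports\<close>

lemma digit_in: "digit L F k \<in> F" and quotient_digit: "L *v quotient L F k + digit L F k = k"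
proof -
  from support obtain f g where fg: "f \<in> F" "k = L *v g + f"
    by (auto simp: is_support_def) metis
  then show "digit L F k \<in> F" "L *v quotient L F k + digit L F k = k"
    by (simp_all add: digit_quotient[OF expansion support])
qed

lemma quotient_shift: "quotient L F (L *v g + k) = g + quotient L F k"
  and digit_shift: "digit L F (L *v g + k) = digit L F k"
proof -
  have "L *v g + k = L *v (g + quotient L F k) + digit L F k"
    using quotient_digit[of k] by (simp add: matrix_vector_right_distrib add.assoc)
  then show "quotient L F (L *v g + k) = g + quotient L F k" "digit L F (L *v g + k) = digit L F k"
    by (simp_all add: digit_quotient[OF expansion support digit_in])
qed

lemma block_shift: "block n (stretch n g + k) = g + block n k"
proof (induction n arbitrary: k)
  case (Suc n)
  show ?case unfolding funpow_Suc_right[of n "quotient L F"] using Suc by (simp add: quotient_shift)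
qed simp

text \<open>The recursion for \<open>F_n\<close> adds one lowest digit, which
  \<open>quotient\<close> removes. Membership thus becomes an equation that
  \<open>block_shift\<close> can evaluate.\<close>

lemma iter_support_iff: "k \<in> iter_support L F n \<longleftrightarrow> block n k = 0"
proof (induction n arbitrary: k)
  case (Suc n)
  have "k \<in> iter_support L F (Suc n) \<longleftrightarrow> quotient L F k \<in> iter_support L F n"
  proof
    assume "k \<in> iter_support L F (Suc n)"
    then obtain f g where "k = L *v g + f" "f \<in> F" "g \<in> iter_support L F n"
      by (auto simp: add.commute)
    then show "quotient L F k \<in> iter_support L F n"
      using digit_quotient[OF expansion support] by simp
  next
    assume "quotient L F k \<in> iter_support L F n"
    then show "k \<in> iter_support L F (Suc n)"
      using digit_in[of k] quotient_digit[of k] by (force simp: add.commute)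
  qed
  with Suc show ?case by (simp add: funpow_Suc_right del: funpow.simps iter_support.simps)
qed simp

lemma finite_iter_support: "finite (iter_support L F n)"
proof (induction n)
  case (Suc n)
  have "iter_support L F (Suc n) = (\<lambda>(f, g). f + L *v g) ` (F \<times> iter_support L F n)" by auto
  with Suc support show ?case by (simp add: is_support_def)
qed simp

text \<open>The translates of \<open>F_n\<close> by \<open>stretch n\<close> cover the lattice:
  subtracting \<open>stretch n (block n k)\<close> moves \<open>k\<close> into block
  \<open>0\<close>.\<close>

lemma block_decomposition:
  obtains f where "f \<in> iter_support L F n" "k = stretch n (block n k) + f"
proof
  show "k = stretch n (block n k) + (k - stretch n (block n k))" by simp
  with block_shift[of n "block n k" "k - stretch n (block n k)"]
  show "k - stretch n (block n k) \<in> iter_support L F n" by (simp add: iter_support_iff)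
qed

lemma block_add: "block (n + m) k = block m (block n k)"
  by (subst add.commute) (simp add: funpow_add)

lemma block_0: "block n 0 = 0"
proof -
  have "quotient L F 0 = 0"
    using digit_quotient(2)[OF expansion support, of 0 0] support by (simp add: is_support_def)
  then show ?thesis by (induction n) auto
qed

text \<open>Only the \<open>n\<close> lowest digits of the position are read, so beyond
  \<open>F_n\<close> the pattern continues periodically.\<close>

lemma subst_iter_shift: "subst_iter L F \<zeta> n a (stretch n g + k) = subst_iter L F \<zeta> n a k"
  by (induction n arbitrary: k) (simp_all add: quotient_shift digit_shift)

lemma subst_conf_eq: "subst_conf n x k = subst_iter L F \<zeta> n (x (block n k)) k"
proof (induction n arbitrary: k)
  case (Suc n)
  then show ?case unfolding funpow_Suc_right by simp
qed simp

lemma subst_conf_const: "subst_conf n (\<lambda>_. a) = subst_iter L F \<zeta> n a"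
  by (simp add: fun_eq_iff subst_conf_eq)

lemma subst_conf_add: "subst_conf (n + m) x = subst_conf n (subst_conf m x)"
  by (induction n) auto

text \<open>The offset \<open>k\<close> may leave \<open>F_n\<close>; the overflow is carried into
  the block index.\<close>

lemma subst_conf_shift:
  "subst_conf n x (stretch n g + k) = subst_iter L F \<zeta> n (x (g + block n k)) k"
  by (simp add: subst_conf_eq subst_iter_shift block_shift)

section \<open>Contraction by the inverse matrix\<close>

lemma norm_le_set_norm: "f \<in> F \<Longrightarrow> norm (real_vec f) \<le> set_norm F"
  using support by (auto simp: set_norm_def is_support_def intro!: Max_ge)

lemma norm_matrix_inv: "norm (matrix_inv (real_mat L) *v v) \<le> op_norm (matrix_inv (real_mat L)) * norm v"
  unfolding op_norm_def by (rule onorm) (rule matrix_vector_mul_bounded_linear)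

lemma op_norm_inv: "0 \<le> op_norm (matrix_inv (real_mat L))" "op_norm (matrix_inv (real_mat L)) < 1"
  using expansion onorm_pos_le[OF matrix_vector_mul_bounded_linear]
  by (auto simp: expansion_matrix_def op_norm_def)

lemma norm_matrix_inv_power:
  "norm (((*v) (matrix_inv (real_mat L)) ^^ n) v) \<le> op_norm (matrix_inv (real_mat L)) ^ n * norm v"
proof (induction n)
  case (Suc n)
  have "norm (((*v) (matrix_inv (real_mat L)) ^^ Suc n) v)
      \<le> op_norm (matrix_inv (real_mat L)) * norm (((*v) (matrix_inv (real_mat L)) ^^ n) v)"
    using norm_matrix_inv by simp
  also have "\<dots> \<le> op_norm (matrix_inv (real_mat L)) * (op_norm (matrix_inv (real_mat L)) ^ n * norm v)"
    using Suc op_norm_inv by (intro mult_left_mono)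
  finally show ?case by (simp add: mult.assoc)
qed simp

lemma matrix_inv_power_add:
  "((*v) (matrix_inv (real_mat L)) ^^ n) (v + w) =
     ((*v) (matrix_inv (real_mat L)) ^^ n) v + ((*v) (matrix_inv (real_mat L)) ^^ n) w"
  by (induction n) (simp_all add: matrix_vector_right_distrib)

text \<open>Expand \<open>k\<close> in base \<open>L\<close> with \<open>n\<close> digits and
  remainder \<open>block n k\<close>. After applying \<open>M ^^ n\<close> the digits contribute
  terms of norm at most \<open>l ^ i * set_norm F\<close> with \<open>1 \<le> i \<le> n\<close>, and
  the geometric series bounds them uniformly in \<open>n\<close>.\<close>

lemma norm_block_diff:
  defines "M \<equiv> (*v) (matrix_inv (real_mat L))"
    and "l \<equiv> op_norm (matrix_inv (real_mat L))"
  shows "norm ((M ^^ n) (real_vec k) - real_vec (block n k)) \<le> l * set_norm F / (1 - l)"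
proof -
  let ?r = "set_norm F"
  have l: "0 \<le> l" "l < 1" using op_norm_inv by (auto simp: l_def)
  note Mn = norm_matrix_inv_power[folded M_def l_def] and Madd = matrix_inv_power_add[folded M_def]
  have M_real_vec: "M (real_vec k) = real_vec (quotient L F k) + M (real_vec (digit L F k))" for k
  proof -
    have inv: "matrix_inv (real_mat L) ** real_mat L = mat 1"
      using expansion unfolding expansion_matrix_def invertible_def matrix_inv_def
      by (metis (mono_tags, lifting) someI_ex)
    have "M (real_vec k) = M (real_vec (L *v quotient L F k + digit L F k))"
      by (simp add: quotient_digit)
    then show ?thesis
      by (simp add: real_vec_add real_vec_mult M_def matrix_vector_right_distrib
          matrix_vector_mul_assoc inv)
  qed
  \<comment> \<open>The partial sum makes the induction close: the lowest digit is contracted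
    \<open>n + 1\<close> times and adds the summand \<open>l ^ n * (l * ?r)\<close>.\<close>
  have "norm ((M ^^ n) (real_vec k) - real_vec (block n k)) \<le> (\<Sum>i<n. l ^ i) * (l * ?r)" for k
  proof (induction n arbitrary: k)
    case (Suc n)
    let ?q = "quotient L F k"
    have "(M ^^ Suc n) (real_vec k) - real_vec (block (Suc n) k)
        = ((M ^^ n) (real_vec ?q) - real_vec (block n ?q)) + (M ^^ n) (M (real_vec (digit L F k)))"
      unfolding funpow_Suc_right by (simp add: M_real_vec[of k] Madd)
    also have "norm \<dots> \<le> (\<Sum>i<n. l ^ i) * (l * ?r) + l ^ n * (l * ?r)"
    proof (rule norm_triangle_mono[OF Suc order_trans[OF Mn]])
      have "norm (M (real_vec (digit L F k))) \<le> l * norm (real_vec (digit L F k))"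
        using norm_matrix_inv by (simp add: M_def l_def)
      also have "\<dots> \<le> l * ?r" using norm_le_set_norm[OF digit_in] l by (intro mult_left_mono)
      finally show "l ^ n * norm (M (real_vec (digit L F k))) \<le> l ^ n * (l * ?r)"
        using l by (intro mult_left_mono) auto
    qed
    finally show ?case by (simp add: algebra_simps)
  qed simp
  also have "(\<Sum>i<n. l ^ i) * (l * ?r) \<le> 1 / (1 - l) * (l * ?r)"
  proof (rule mult_right_mono)
    show "(\<Sum>i<n. l ^ i) \<le> 1 / (1 - l)" using l by (simp add: sum_gp_strict divide_right_mono)
    have "0 \<in> F" using support by (simp add: is_support_def)
    from norm_le_set_norm[OF this] have "0 \<le> ?r" using norm_ge_zero order_trans by blast
    with l show "0 \<le> l * ?r" by simp
  qed
  finally show ?thesis by simp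
qed

text \<open>Source of the factor 3 in \<open>aut_bound\<close>: with \<open>c\<close> the bound of
  \<open>norm_block_diff\<close>, the points \<open>f\<close> and \<open>j\<close> contribute
  \<open>c\<close> each, and passing to the block index costs a third \<open>c\<close>. For large
  \<open>n\<close> the contracted \<open>e\<close> adds at most 1.\<close>

lemma block_sum_bounded:
  fixes E :: "(int ^ 'd) set"
  assumes "finite E"
  defines "l \<equiv> op_norm (matrix_inv (real_mat L))"
  shows "\<exists>N. \<forall>n\<ge>N. \<forall>f\<in>iter_support L F n. \<forall>j\<in>iter_support L F n. \<forall>e\<in>E. \<forall>i.
           \<bar>block n (f - j + e) $ i\<bar> \<le> int (nat \<lceil>3 * l * set_norm F / (1 - l)\<rceil> + 1)"
proof -
  define c where "c = l * set_norm F / (1 - l)"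
  let ?M = "(*v) (matrix_inv (real_mat L))"
  have l: "0 \<le> l" "l < 1" using op_norm_inv by (auto simp: l_def)
  note Mn = norm_matrix_inv_power[folded l_def] and Madd = matrix_inv_power_add
  have Mminus: "(?M ^^ n) (- v) = - (?M ^^ n) v" for n v
    by (induction n) (simp_all add: matrix_vector_mult_def vec_eq_iff sum_negf)
  obtain R where R: "R > 0" "\<And>e. e \<in> E \<Longrightarrow> norm (real_vec e) \<le> R"
    using finite_imp_bounded[OF finite_imageI[OF assms(1), of real_vec]]
    by (auto simp: bounded_pos)
  \<comment> \<open>Only the threshold \<open>N\<close> depends on \<open>E\<close>; the final bound
    does not.\<close>
  have "(\<lambda>n. l ^ n * R) \<longlonglongrightarrow> 0" using l by (intro tendsto_mult_left_zero LIMSEQ_power_zero) auto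
  then have "\<forall>\<^sub>F n in sequentially. l ^ n * R < 1" by (rule order_tendstoD) simp
  then obtain N where N: "\<And>n. n \<ge> N \<Longrightarrow> l ^ n * R < 1" by (auto simp: eventually_sequentially)
  have "\<bar>block n (f - j + e) $ i\<bar> \<le> int (nat \<lceil>3 * l * set_norm F / (1 - l)\<rceil> + 1)"
    if n: "n \<ge> N" and f: "f \<in> iter_support L F n" and j: "j \<in> iter_support L F n" and e: "e \<in> E"
    for n f j e i
  proof -
    let ?b = "block n (f - j + e)"
    have small: "norm ((?M ^^ n) (real_vec k)) \<le> c" if "k \<in> iter_support L F n" for k
      using norm_block_diff[of n k] that
      by (simp add: c_def l_def iter_support_iff real_vec_def zero_vec_def[symmetric])
    have e1: "norm ((?M ^^ n) (real_vec e)) \<le> 1"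
    proof -
      have "l ^ n * norm (real_vec e) \<le> l ^ n * R" using R(2)[OF e] l by (intro mult_left_mono) auto
      with Mn[of n "real_vec e"] N[OF n] show ?thesis by linarith
    qed
    have "(?M ^^ n) (real_vec (f - j + e))
        = (?M ^^ n) (real_vec f) - (?M ^^ n) (real_vec j) + (?M ^^ n) (real_vec e)"
      by (simp only: diff_conv_add_uminus real_vec_add real_vec_uminus Madd Mminus)
    then have "norm ((?M ^^ n) (real_vec (f - j + e))) \<le> c + c + 1"
      using small[OF f] small[OF j] e1 by (smt (verit) norm_triangle_ineq norm_triangle_ineq4)
    moreover have "norm (real_vec ?b - (?M ^^ n) (real_vec (f - j + e))) \<le> c"
      using norm_block_diff[of n "f - j + e"] by (simp add: c_def l_def norm_minus_commute)
    ultimately have "norm (real_vec ?b) \<le> 3 * c + 1"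
      using norm_triangle_sub[of "real_vec ?b" "(?M ^^ n) (real_vec (f - j + e))"]
      by linarith
    moreover have "\<bar>real_of_int (?b $ i)\<bar> \<le> norm (real_vec ?b)"
      using component_le_norm_cart[of "real_vec ?b" i] by (simp add: real_vec_def)
    ultimately have "real_of_int \<bar>?b $ i\<bar> \<le> 3 * c + 1" by simp
    also have "3 * c = 3 * l * set_norm F / (1 - l)" by (simp add: c_def)
    finally show ?thesis by linarith
  qed
  then show ?thesis by blast
qed

end


section \<open>Minimality and desubstitution\<close>

text \<open>\<open>letter_injective\<close> is the form in which reducedness enters: a positive
  distance separates the iterates of distinct letters. Level 0 is trivial.\<close>

locale primitive_injective_substitution = expanding_substitution L F \<zeta>
  for L :: "int ^ 'd ^ 'd" and F :: "(int ^ 'd) set" and \<zeta> :: "'a::finite \<Rightarrow> int ^ 'd \<Rightarrow> 'a" +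
  assumes primitive: "primitive_subst L F \<zeta>"
    and letter_injective:
      "(\<And>f. f \<in> iter_support L F n \<Longrightarrow> subst_iter L F \<zeta> n a f = subst_iter L F \<zeta> n b f) \<Longrightarrow> a = b"
begin

abbreviation X where "X \<equiv> subst_shift L F \<zeta>"

text \<open>The pattern occurs in \<open>\<zeta>\<^sup>N a\<close> for some letter \<open>a\<close>.
  By primitivity \<open>a\<close> occurs in the \<open>q\<close>-th iterate of every letter, hence
  below any letter of any higher iterate.\<close>

lemma pattern_in_all_large_iterates:
  assumes z: "z \<in> X" and P: "finite P"
  shows "\<exists>N. \<forall>M\<ge>N. \<forall>b. \<exists>s. \<forall>p\<in>P. s + p \<in> iter_support L F M \<and> subst_iter L F \<zeta> M b (s + p) = z p"
proof -
  from primitive obtain q where q: "\<And>a b. \<exists>f\<in>iter_support L F q. subst_iter L F \<zeta> q a f = b"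
    by (auto simp: primitive_subst_def)
  have "occurs_in P z UNIV z" by (auto simp: occurs_in_def intro!: exI[of _ 0])
  with z P have "\<exists>n>0. \<exists>a. occurs_in P z (iter_support L F n) (subst_iter L F \<zeta> n a)"
    unfolding subst_shift_def mem_Collect_eq by (elim allE[of _ P] allE[of _ z] mp) (rule conjI)
  then obtain N a where "occurs_in P z (iter_support L F N) (subst_iter L F \<zeta> N a)" by metis
  then obtain s where
    s: "\<And>p. p \<in> P \<Longrightarrow> s + p \<in> iter_support L F N \<and> subst_iter L F \<zeta> N a (s + p) = z p"
    unfolding occurs_in_def by metis
  have "\<exists>t. \<forall>p\<in>P. t + p \<in> iter_support L F M \<and> subst_iter L F \<zeta> M b (t + p) = z p"
    if M: "M \<ge> N + q" for M b
  proof -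
    \<comment> \<open>The surplus levels are spent on the letter at position \<open>0\<close> of the
      \<open>m\<close>-th iterate, whose descendants stay in \<open>F_M\<close> because
      \<open>block_0\<close> keeps the origin in block \<open>0\<close>.\<close>
    define m where "m = M - (N + q)"
    have M_eq: "M = N + (q + m)" using M by (simp add: m_def)
    obtain f where f: "f \<in> iter_support L F q" "subst_iter L F \<zeta> q (subst_iter L F \<zeta> m b 0) f = a"
      using q by blast
    show ?thesis
    proof (intro exI ballI conjI)
      fix p assume p: "p \<in> P"
      have b0: "block N (s + p) = 0" using s[OF p] by (simp add: iter_support_iff)
      have shift_eq: "stretch N f + s + p = stretch N f + (s + p)" by simp
      have "block M (stretch N f + s + p) = block m (block q (block N (stretch N f + s + p)))"
        by (simp only: M_eq block_add)
      also have "\<dots> = 0"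
        unfolding shift_eq block_shift b0 using f(1) by (simp add: iter_support_iff block_0)
      finally show "stretch N f + s + p \<in> iter_support L F M" by (simp add: iter_support_iff)
      have "subst_iter L F \<zeta> M b (stretch N f + s + p)
          = subst_conf N (subst_conf q (subst_conf m (\<lambda>_. b))) (stretch N f + (s + p))"
        by (simp only: subst_conf_const[symmetric] M_eq subst_conf_add shift_eq)
      also have "\<dots> = subst_iter L F \<zeta> N (subst_conf q (subst_iter L F \<zeta> m b) f) (s + p)"
        by (simp add: subst_conf_shift b0 subst_conf_const)
      also have "subst_conf q (subst_iter L F \<zeta> m b) f = a"
        using f by (simp add: subst_conf_eq iter_support_iff)
      finally show "subst_iter L F \<zeta> M b (stretch N f + s + p) = z p" using s[OF p] by simp
    qed
  qed
  then show ?thesis by blast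
qed

text \<open>A finite pattern of \<open>\<zeta>\<^sup>n x\<close> involves finitely many letters of
  \<open>x\<close>. They occur together in an iterate of a letter, and
  \<open>\<zeta>\<^sup>n\<close> of that iterate contains the pattern.\<close>

lemma subst_conf_in_shift:
  assumes x: "x \<in> X"
  shows "subst_conf n x \<in> X"
  unfolding subst_shift_def
proof (intro CollectI allI impI, elim conjE)
  fix P and w :: "int ^ 'd \<Rightarrow> 'a"
  assume P: "finite P" and w: "occurs_in P w UNIV (subst_conf n x)"
  from w obtain u where u: "\<And>p. p \<in> P \<Longrightarrow> subst_conf n x (u + p) = w p" by (auto simp: occurs_in_def)
  from pattern_in_all_large_iterates[OF x, of "(\<lambda>p. block n (u + p)) ` P"] P
  obtain N where N: "\<And>M b. M \<ge> N \<Longrightarrow> \<exists>s. \<forall>p\<in>P. s + block n (u + p) \<in> iter_support L F M \<and>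
      subst_iter L F \<zeta> M b (s + block n (u + p)) = x (block n (u + p))"
    by (auto 4 3)
  \<comment> \<open>The successor keeps the exponent \<open>n + M\<close> positive even for
    \<open>n = 0\<close>.\<close>
  define M where "M = Suc N"
  fix b :: 'a
  obtain s where s: "\<And>p. p \<in> P \<Longrightarrow> s + block n (u + p) \<in> iter_support L F M \<and>
      subst_iter L F \<zeta> M b (s + block n (u + p)) = x (block n (u + p))"
    using N[of M b] by (auto simp: M_def)
  have "occurs_in P w (iter_support L F (n + M)) (subst_iter L F \<zeta> (n + M) b)"
    unfolding occurs_in_def
  proof (intro exI ballI conjI)
    fix p assume p: "p \<in> P"
    have eq: "stretch n s + u + p = stretch n s + (u + p)" by simp
    have "block (n + M) (stretch n s + u + p) = block M (block n (stretch n s + u + p))"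
      by (rule block_add)
    also have "\<dots> = 0"
      unfolding eq block_shift using s[OF p] by (simp add: iter_support_iff)
    finally show "stretch n s + u + p \<in> iter_support L F (n + M)" by (simp add: iter_support_iff)
    have "subst_iter L F \<zeta> (n + M) b (stretch n s + u + p)
        = subst_conf n (subst_iter L F \<zeta> M b) (stretch n s + (u + p))"
      by (simp only: subst_conf_const[symmetric] subst_conf_add eq)
    also have "\<dots> = subst_conf n x (u + p)"
      using s[OF p] by (simp add: subst_conf_shift) (simp add: subst_conf_eq)
    finally show "subst_iter L F \<zeta> (n + M) b (stretch n s + u + p) = w p" using u[OF p] by simp
  qed
  moreover have "n + M > 0" by (simp add: M_def)
  ultimately show "\<exists>n>0. \<exists>a. occurs_in P w (iter_support L F n) (subst_iter L F \<zeta> n a)"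
    by (intro exI[of _ "n + M"] exI[of _ b] conjI)
qed

text \<open>If every \<open>j\<close> failed on some block, the finitely many failing blocks together would be a
  pattern of \<open>z\<close>, which occurs in an iterate of \<open>\<zeta>\<^sup>n\<close>.\<close>

lemma desubstitution:
  assumes z: "z \<in> X"
  obtains j y where "j \<in> iter_support L F n" "z = shift j (subst_conf n y)"
proof -
  let ?F = "iter_support L F n"
  have "\<exists>j\<in>?F. \<forall>g. \<exists>a. \<forall>f\<in>?F. z (stretch n g + f - j) = subst_iter L F \<zeta> n a f"
  proof (rule ccontr)
    assume "\<not> ?thesis"
    then obtain g where g: "\<And>j a. j \<in> ?F \<Longrightarrow> \<exists>f\<in>?F. z (stretch n (g j) + f - j) \<noteq> subst_iter L F \<zeta> n a f"
      by metis
    define P where "P = (\<lambda>(j, f). stretch n (g j) + f - j) ` (?F \<times> ?F)"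
    have "finite P" by (simp add: P_def finite_iter_support)
    from pattern_in_all_large_iterates[OF z this] obtain N where
      N: "\<And>M b. M \<ge> N \<Longrightarrow> \<exists>s. \<forall>p\<in>P. subst_iter L F \<zeta> M b (s + p) = z p" by blast
    fix b :: 'a
    from N[of "n + N" b] obtain s where
      s: "\<And>p. p \<in> P \<Longrightarrow> subst_iter L F \<zeta> (n + N) b (s + p) = z p" by auto
    \<comment> \<open>The residue of the occurrence \<open>s\<close> selects \<open>j\<close>: with
      this choice the failing block at \<open>g j\<close> is aligned with the
      \<open>n\<close>-blocks of the iterate, where it is the image of the letter
      \<open>?a\<close>.\<close>
    obtain j where j: "j \<in> ?F" "s = stretch n (block n s) + j" using block_decomposition by blast
    show False
    proof -
      let ?a = "subst_iter L F \<zeta> N b (block n s + g j)"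
      obtain f where f: "f \<in> ?F" "z (stretch n (g j) + f - j) \<noteq> subst_iter L F \<zeta> n ?a f"
        using g[OF j(1)] by blast
      have add: "stretch n (g + h) = stretch n g + stretch n h" for g h
        by (induction n) (simp_all add: matrix_vector_right_distrib)
      have "stretch n (g j) + f - j \<in> P" using j f by (auto simp: P_def)
      from s[OF this] have "z (stretch n (g j) + f - j)
          = subst_conf n (subst_iter L F \<zeta> N b) (s + (stretch n (g j) + f - j))"
        by (simp only: subst_conf_const[symmetric] subst_conf_add)
      also have "s + (stretch n (g j) + f - j) = stretch n (block n s + g j) + f"
        by (subst (1) j(2)) (simp add: add algebra_simps)
      also have "subst_conf n (subst_iter L F \<zeta> N b) \<dots> = subst_iter L F \<zeta> n ?a f"
        using f(1) by (simp add: subst_conf_shift iter_support_iff)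
      finally show False using f(2) by simp
    qed
  qed
  then obtain j y where j: "j \<in> ?F"
    and y: "\<And>g f. f \<in> ?F \<Longrightarrow> z (stretch n g + f - j) = subst_iter L F \<zeta> n (y g) f"
    by metis
  have "z = shift j (subst_conf n y)"
  proof
    fix k
    obtain f where f: "f \<in> ?F" "j + k = stretch n (block n (j + k)) + f"
      using block_decomposition by blast
    have "k = stretch n (block n (j + k)) + f - j" by (simp flip: f(2))
    then have "z k = subst_iter L F \<zeta> n (y (block n (j + k))) f" using y[OF f(1)] by metis
    also have "\<dots> = subst_conf n y (stretch n (block n (j + k)) + f)"
      using f(1) by (simp add: subst_conf_shift iter_support_iff)
    finally show "z k = shift j (subst_conf n y) k" by (simp add: shift_def flip: f(2))
  qed
  with j that show thesis by blast
qed

text \<open>Minimality in combinatorial form: \<open>w\<close> is cut into blocks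
  \<open>\<zeta>\<^sup>M b\<close>, and for large \<open>M\<close> each such block contains the
  pattern.\<close>

lemma pattern_in_every_point:
  assumes z: "z \<in> X" and w: "w \<in> X" and P: "finite P"
  shows "\<exists>s. \<forall>p\<in>P. w (s + p) = z p"
proof -
  from pattern_in_all_large_iterates[OF z P] obtain M where
    M: "\<And>b. \<exists>s. \<forall>p\<in>P. s + p \<in> iter_support L F M \<and> subst_iter L F \<zeta> M b (s + p) = z p" by blast
  from desubstitution[OF w] obtain j y where j: "w = shift j (subst_conf M y)" by metis
  from M[of "y 0"] obtain s where
    s: "\<And>p. p \<in> P \<Longrightarrow> s + p \<in> iter_support L F M \<and> subst_iter L F \<zeta> M (y 0) (s + p) = z p" by blast
  have "w (s - j + p) = z p" if "p \<in> P" for p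
  proof -
    have "j + (s - j + p) = s + p" by simp
    with s[OF that] show ?thesis by (simp add: j shift_def subst_conf_eq iter_support_iff)
  qed
  then show ?thesis by blast
qed


section \<open>Counting automorphisms\<close>

text \<open>Both sides are local rules, and every finite window of \<open>z\<close> occurs in
  \<open>w\<close>, so equality along \<open>w\<close> passes to \<open>z\<close>.\<close>

lemma Aut_eq_shift_if_eq_at_point:
  assumes \<phi>: "\<phi> \<in> carrier (Aut_shift X)" and \<psi>: "\<psi> \<in> carrier (Aut_shift X)"
    and w: "w \<in> X" and eq: "\<phi> w = shift t (\<psi> w)"
  shows "\<phi> = restrict (shift t) X \<otimes>\<^bsub>Aut_shift X\<^esub> \<psi>"
proof -
  note inv = shift_in_subst_shift[of _ L F \<zeta>]
  obtain E where E: "finite E" "\<And>x y k m. x \<in> X \<Longrightarrow> y \<in> X \<Longrightarrow>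
      (\<And>e. e \<in> E \<Longrightarrow> x (k + e) = y (m + e)) \<Longrightarrow> \<phi> x k = \<phi> y m"
    using Aut_shift_local_rule[OF closedin_subst_shift inv \<phi>] by metis
  obtain E' where E': "finite E'" "\<And>x y k m. x \<in> X \<Longrightarrow> y \<in> X \<Longrightarrow>
      (\<And>e. e \<in> E' \<Longrightarrow> x (k + e) = y (m + e)) \<Longrightarrow> \<psi> x k = \<psi> y m"
    using Aut_shift_local_rule[OF closedin_subst_shift inv \<psi>] by metis
  have "\<phi> z = shift t (\<psi> z)" if z: "z \<in> X" for z
  proof
    fix k
    \<comment> \<open>One window serves both rules: \<open>E\<close> for \<open>\<phi>\<close> at
      \<open>k\<close>, and the translate of \<open>E'\<close> by \<open>t\<close> for
      \<open>\<psi>\<close> at \<open>t + k\<close>.\<close>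
    have "\<exists>s. \<forall>p\<in>E \<union> (+) t ` E'. w (s + p) = shift k z p"
      using E(1) E'(1) by (intro pattern_in_every_point inv z w) auto
    then obtain s where s: "\<And>p. p \<in> E \<union> (+) t ` E' \<Longrightarrow> w (s + p) = z (k + p)"
      by (auto simp: shift_def)
    have "\<phi> z k = \<phi> w s" using z w s by (intro E(2)) auto
    also have "\<dots> = \<psi> w (t + s)" by (simp add: eq shift_def)
    also have "\<dots> = \<psi> z (t + k)"
    proof (intro E'(2) z w)
      fix e assume "e \<in> E'"
      then have "w (s + (t + e)) = z (k + (t + e))" by (intro s) auto
      then show "w (t + s + e) = z (t + k + e)" by (simp add: ac_simps)
    qed
    finally show "\<phi> z k = shift t (\<psi> z) k" by (simp add: shift_def)
  qed
  moreover have "\<psi> z \<in> X" if "z \<in> X" for z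
    using \<psi> that Bij_imp_funcset by (fastforce simp: Aut_shift_def)
  moreover have "\<phi> \<in> extensional X" using \<phi> by (simp add: Aut_shift_def Bij_def)
  moreover have "restrict (shift t) X \<in> carrier (Aut_shift X)"
    by (rule shift_in_Aut_shift) (rule inv)
  ultimately show ?thesis
    using \<psi> by (auto simp: mult_Aut_shift compose_def extensional_def)
qed

text \<open>The cube from \<open>block_sum_bounded\<close>, the same for all automorphisms and all
  levels.\<close>

abbreviation window :: "(int ^ 'd) set" where
  "window \<equiv> {b. \<forall>i. \<bar>b $ i\<bar> \<le> int (nat \<lceil>3 * op_norm (matrix_inv (real_mat L)) * set_norm F /
     (1 - op_norm (matrix_inv (real_mat L)))\<rceil> + 1)}"

text \<open>The block of \<open>y g\<close> is computed by \<open>\<phi>\<close> from letters of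
  \<open>\<zeta>\<^sup>n x\<close> whose block indices lie in \<open>g + window\<close>. Equal
  windows of \<open>x\<close> therefore yield equal blocks, and \<open>letter_injective\<close>
  turns these into equal letters of \<open>y\<close>.\<close>

lemma renormalized_rule:
  assumes \<phi>: "\<phi> \<in> carrier (Aut_shift X)"
  shows "\<exists>N. \<forall>n\<ge>N. \<forall>x\<in>X. \<exists>r\<in>(window \<rightarrow>\<^sub>E UNIV) \<rightarrow>\<^sub>E UNIV. \<exists>j.
    \<phi> (subst_conf n x) = shift j (subst_conf n (\<lambda>g. r (\<lambda>b\<in>window. x (g + b))))"
proof -
  note inv = shift_in_subst_shift[of _ L F \<zeta>]
  obtain E where E: "finite E" "\<And>x y k m. x \<in> X \<Longrightarrow> y \<in> X \<Longrightarrow>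
      (\<And>e. e \<in> E \<Longrightarrow> x (k + e) = y (m + e)) \<Longrightarrow> \<phi> x k = \<phi> y m"
    using Aut_shift_local_rule[OF closedin_subst_shift inv \<phi>] by metis
  obtain N where N: "\<And>n f j e. n \<ge> N \<Longrightarrow> f \<in> iter_support L F n \<Longrightarrow> j \<in> iter_support L F n \<Longrightarrow>
      e \<in> E \<Longrightarrow> block n (f - j + e) \<in> window"
    using block_sum_bounded[OF E(1)] by blast
  have rule: "\<exists>r\<in>(window \<rightarrow>\<^sub>E UNIV) \<rightarrow>\<^sub>E UNIV. \<exists>j.
      \<phi> (subst_conf n x) = shift j (subst_conf n (\<lambda>g. r (\<lambda>b\<in>window. x (g + b))))"
    if n: "n \<ge> N" and x: "x \<in> X" for n x
  proof -
    let ?w = "subst_conf n x"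
    have w: "?w \<in> X" by (rule subst_conf_in_shift[OF x])
    have "\<phi> ?w \<in> X" using \<phi> w Bij_imp_funcset by (fastforce simp: Aut_shift_def)
    then obtain j y where j: "j \<in> iter_support L F n" and y: "\<phi> ?w = shift j (subst_conf n y)"
      by (rule desubstitution)
    let ?p = "\<lambda>g. \<lambda>b\<in>window. x (g + b)"
    have local: "y g = y h" if p: "?p g = ?p h" for g h
    proof (rule letter_injective)
      fix f assume f: "f \<in> iter_support L F n"
      have letter: "subst_iter L F \<zeta> n (y k) f = \<phi> ?w (stretch n k + f - j)" for k
        using f by (simp add: y shift_def subst_conf_shift iter_support_iff)
      have "\<phi> ?w (stretch n g + f - j) = \<phi> ?w (stretch n h + f - j)"
      proof (rule E(2)[OF w w])
        fix e assume e: "e \<in> E"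
        have "?w (stretch n k + f - j + e)
            = subst_iter L F \<zeta> n (x (k + block n (f - j + e))) (f - j + e)" for k
          using subst_conf_shift[of n x k "f - j + e"] by (simp add: algebra_simps)
        moreover have "x (g + block n (f - j + e)) = x (h + block n (f - j + e))"
          using fun_cong[OF p, of "block n (f - j + e)"] N[OF n f j e]
          by (simp only: restrict_apply if_True)
        ultimately show "?w (stretch n g + f - j + e) = ?w (stretch n h + f - j + e)" by simp
      qed
      then show "subst_iter L F \<zeta> n (y g) f = subst_iter L F \<zeta> n (y h) f" by (simp add: letter)
    qed
    \<comment> \<open>By \<open>local\<close> any position showing the pattern \<open>u\<close>
      gives the same letter. Patterns absent from \<open>x\<close> receive an arbitrary letter, and
      restricting the domain puts \<open>r\<close> into the finite set to be counted.\<close>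
    define r where "r = restrict (\<lambda>u. y (SOME g. ?p g = u)) (window \<rightarrow>\<^sub>E UNIV)"
    have "r (?p g) = y g" for g
    proof -
      have "?p g \<in> window \<rightarrow>\<^sub>E UNIV" by (rule restrict_PiE_iff[THEN iffD2]) simp
      then have "r (?p g) = y (SOME h. ?p h = ?p g)" unfolding r_def by (rule restrict_apply')
      also have "\<dots> = y g" by (rule local, rule someI[of "\<lambda>h. ?p h = ?p g"]) (rule refl)
      finally show ?thesis .
    qed
    then have "\<phi> ?w = shift j (subst_conf n (\<lambda>g. r (?p g)))" by (simp only: y)
    moreover have "r \<in> (window \<rightarrow>\<^sub>E UNIV) \<rightarrow>\<^sub>E UNIV"
      unfolding r_def by (rule restrict_PiE_iff[THEN iffD2]) simp
    ultimately show ?thesis by blast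
  qed
  show ?thesis by (intro exI[of _ N] allI impI ballI; rule rule)
qed

lemma card_window_rules:
  "finite ((window \<rightarrow>\<^sub>E (UNIV :: 'a set)) \<rightarrow>\<^sub>E (UNIV :: 'a set))"
  "card ((window \<rightarrow>\<^sub>E (UNIV :: 'a set)) \<rightarrow>\<^sub>E (UNIV :: 'a set)) =
     aut_bound CARD('d) CARD('a) (op_norm (matrix_inv (real_mat L))) (set_norm F)"
proof -
  have size: "2 * (c + 1) + 1 = 2 * c + 3" for c :: nat by simp
  have fin: "finite window" and card: "card window =
      (2 * nat \<lceil>3 * op_norm (matrix_inv (real_mat L)) * set_norm F /
         (1 - op_norm (matrix_inv (real_mat L)))\<rceil> + 3) ^ CARD('d)"
    by (rule card_int_vec_cube(1)) (simp only: card_int_vec_cube(2) size)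
  have fin': "finite (window \<rightarrow>\<^sub>E (UNIV :: 'a set))" by (rule finite_PiE[OF fin]) simp
  then show "finite ((window \<rightarrow>\<^sub>E (UNIV :: 'a set)) \<rightarrow>\<^sub>E (UNIV :: 'a set))" by (rule finite_PiE) simp
  show "card ((window \<rightarrow>\<^sub>E (UNIV :: 'a set)) \<rightarrow>\<^sub>E (UNIV :: 'a set)) =
     aut_bound CARD('d) CARD('a) (op_norm (matrix_inv (real_mat L))) (set_norm F)"
    unfolding card_PiE[OF fin'] prod_constant card_PiE[OF fin] card aut_bound_def ..
qed

text \<open>The threshold of \<open>renormalized_rule\<close> varies with the automorphism. A finite
  set of cosets has a common level \<open>n\<close>, at which distinct cosets must have distinct
  rules.\<close>

lemma finite_cosets_bound:
  assumes S: "S \<subseteq> carrier (Aut_shift X Mod shift_group X)" "finite S" and x: "x \<in> X"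
  shows "card S \<le> aut_bound CARD('d) CARD('a) (op_norm (matrix_inv (real_mat L))) (set_norm F)"
proof -
  note inv = shift_in_subst_shift[of _ L F \<zeta>]
  interpret A: group "Aut_shift X" by (rule group_Aut_shift) (rule inv)
  have "shift_group X \<lhd> Aut_shift X" by (rule normal_shift_group) (rule inv)
  then have sub: "subgroup (shift_group X) (Aut_shift X)" by (rule normal_imp_subgroup)
  have "\<exists>\<phi>\<in>carrier (Aut_shift X). shift_group X #>\<^bsub>Aut_shift X\<^esub> \<phi> = C" if "C \<in> S" for C
    using that S(1) by (auto simp: FactGroup_def RCOSETS_def)
  then obtain \<phi> where \<phi>: "\<And>C. C \<in> S \<Longrightarrow> \<phi> C \<in> carrier (Aut_shift X)"
      "\<And>C. C \<in> S \<Longrightarrow> shift_group X #>\<^bsub>Aut_shift X\<^esub> \<phi> C = C"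
    by metis
  define R where "R = ((window \<rightarrow>\<^sub>E (UNIV :: 'a set)) \<rightarrow>\<^sub>E (UNIV :: 'a set))"
  define code where "code n C r j \<longleftrightarrow>
      \<phi> C (subst_conf n x) = shift j (subst_conf n (\<lambda>g. r (\<lambda>b\<in>window. x (g + b))))" for n C r j
  have "\<exists>N. \<forall>n\<ge>N. \<exists>r\<in>R. \<exists>j. code n C r j" if C: "C \<in> S" for C
    unfolding R_def code_def
    by (rule ex_forward[OF renormalized_rule[OF \<phi>(1)[OF C]]], intro allI impI,
        drule spec, drule (1) mp, drule bspec[OF _ x])
  then obtain N where N: "\<And>C n. C \<in> S \<Longrightarrow> n \<ge> N C \<Longrightarrow> \<exists>r\<in>R. \<exists>j. code n C r j"
    by metis
  \<comment> \<open>For empty \<open>S\<close> this maximum is unspecified, but the claims about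
    \<open>C \<in> S\<close> are then vacuous.\<close>
  define n where "n = Max (N ` S)"
  have "\<exists>r\<in>R. \<exists>j. code n C r j" if "C \<in> S" for C
    using that S(2) by (intro N) (auto simp: n_def)
  then obtain r j where r: "\<And>C. C \<in> S \<Longrightarrow> r C \<in> R" and "\<And>C. C \<in> S \<Longrightarrow> code n C (r C) (j C)"
    by metis
  note j = this(2)[unfolded code_def]
  have "inj_on r S"
  proof (rule inj_onI)
    fix C D assume CD: "C \<in> S" "D \<in> S" "r C = r D"
    \<comment> \<open>Equal rules give the same desubstituted point, so only the offsets
      \<open>j C\<close> and \<open>j D\<close> differ.\<close>
    have "\<phi> C (subst_conf n x) = shift (j C - j D) (\<phi> D (subst_conf n x))"
      by (simp only: j[OF CD(1)] j[OF CD(2)] CD(3) shift_shift diff_add_cancel)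
    from Aut_eq_shift_if_eq_at_point[OF \<phi>(1)[OF CD(1)] \<phi>(1)[OF CD(2)] subst_conf_in_shift[OF x] this]
    have "\<phi> C \<in> shift_group X #>\<^bsub>Aut_shift X\<^esub> \<phi> D"
      by (auto simp: r_coset_def shift_group_def)
    from A.repr_independence[OF this \<phi>(1)[OF CD(2)] sub] show "C = D"
      by (simp add: \<phi>(2) CD)
  qed
  with r have "card S \<le> card R"
    by (intro card_inj_on_le[of r] card_window_rules(1)[folded R_def]) auto
  then show ?thesis unfolding R_def card_window_rules(2) .
qed

end

theorem proposition4p9:
  fixes L :: "int ^ 'd ^ 'd"
    and F :: "(int ^ 'd) set"
    and \<zeta> :: "'a::finite \<Rightarrow> int ^ 'd \<Rightarrow> 'a"
  assumes "expansion_matrix L"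
    and "is_support L F"
    and "folner (iter_support L F)"
    and "aperiodic_subshift (subst_shift L F \<zeta>)"
    and "primitive_subst L F \<zeta>"
    and "reduced_subst L F \<zeta>"
  shows "finite (carrier (Aut_shift (subst_shift L F \<zeta>) Mod shift_group (subst_shift L F \<zeta>))) \<and>
    order (Aut_shift (subst_shift L F \<zeta>) Mod shift_group (subst_shift L F \<zeta>))
      \<le> aut_bound CARD('d) CARD('a) (op_norm (matrix_inv (real_mat L))) (set_norm F)"
proof -
  let ?X = "subst_shift L F \<zeta>"
  let ?Q = "Aut_shift ?X Mod shift_group ?X"
  let ?B = "aut_bound CARD('d) CARD('a) (op_norm (matrix_inv (real_mat L))) (set_norm F)"
  have letters: "a = b"
    if eq: "\<And>f. f \<in> iter_support L F n \<Longrightarrow> subst_iter L F \<zeta> n a f = subst_iter L F \<zeta> n b f" for n a b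
  proof (rule ccontr)
    assume "a \<noteq> b"
    \<comment> \<open>The infimum ranges over positive levels; at level 0 the agreement at the
      origin is already \<open>a = b\<close>.\<close>
    moreover from this eq[of 0] have "n > 0" by (cases n) auto
    ultimately have "(INF (n, a, b) \<in> {(n, a, b). 0 < n \<and> a \<noteq> b}. ereal (iter_dist L F \<zeta> n a b))
        \<le> ereal (iter_dist L F \<zeta> n a b)"
      by (intro INF_lower2[of "(n, a, b)"]) auto
    with assms(6) have "ereal (iter_dist L F \<zeta> n a b) > 0"
      unfolding reduced_subst_def by (rule less_le_trans)
    moreover have "{f \<in> iter_support L F n. subst_iter L F \<zeta> n a f \<noteq> subst_iter L F \<zeta> n b f} = {}"
      using eq by auto
    then have "iter_dist L F \<zeta> n a b = 0"
      by (simp only: iter_dist_def card.empty of_nat_0 div_0)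
    ultimately show False by simp
  qed
  interpret primitive_injective_substitution L F \<zeta>
    by unfold_locales (use assms letters in blast)+
  have bound: "card S \<le> ?B" if S: "S \<subseteq> carrier ?Q" "finite S" for S
  proof (cases "?X = {}")
    case True
    \<comment> \<open>On the empty set there is just one extensional function, hence at most one
      coset.\<close>
    have "f = g" if "f \<in> carrier (Aut_shift ?X)" "g \<in> carrier (Aut_shift ?X)" for f g
      using that True by (auto simp: Aut_shift_def Bij_def)
    then have single: "C = D" if "C \<in> carrier ?Q" "D \<in> carrier ?Q" for C D
      using that by (auto simp: FactGroup_def RCOSETS_def)
    have "card S \<le> 1"
      unfolding One_nat_def card_le_Suc0_iff_eq[OF S(2)]
      by (intro ballI single) (erule subsetD[OF S(1)])+
    also have "1 \<le> ?B" by (simp add: aut_bound_def Suc_leI)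
    finally show ?thesis .
  next
    case False
    with finite_cosets_bound[OF S] show ?thesis by blast
  qed
  \<comment> \<open>A uniform bound on all finite subsets yields both finiteness and the bound for
    the whole quotient.\<close>
  then have "finite (carrier ?Q) \<and> card (carrier ?Q) \<le> ?B" by (intro finite_if_finite_subsets_card_bdd) auto
  then show ?thesis by (simp add: order_def)
qed

end
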